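(* Let $h \geq 2$ be an integer and let $t$ be an integer such that $$t \geq 1 + \frac{\log h}{\log 2}.$$ Let $\mathcal{W} = (W_i)_{i=0}^{h-1}$ be a partition of $\mathbf{N}_0$ such that, for all $i \in [0,h-1]$, there is an infinite set $\mathcal{M}_i$ of positive integers such that $$[M_i - t + 1, M_i] \subseteq W_i$$ for all $M_i \in \mathcal{M}_i$. Let $\mathcal{G} = (g_i)_{i=0}^{\infty}$ be a $\mathcal{G}$-adic sequence. Then the set $$A_{\mathcal{G}}(\mathcal{W}) = \bigcup_{i=0}^{h-1} A_{\mathcal{G}}(W_i)$$ is a minimal asymptotic basis of order $h$.
   Context: $\mathbf{N}_0 = \{0,1,2,\ldots\}$. For integers $u \le v$, $[u,v] = \{x \in \mathbf{N}_0 : u \leq x \leq v\}$. For $A \subseteq \mathbf{N}_0$ and a positive integer $h$, the $h$-fold sumset is $hA = \{a_1 + \cdots + a_h : a_i \in A \text{ for all } i = 1,\ldots,h\}$ (summands not necessarily distinct). The set $A$ is an asymptotic basis of order $h$ if $hA$ contains all sufficiently large integers. An asymptotic basis $A$ of order $h$ is minimal if no proper subset of $A$ is an asymptotic basis of order $h$. A $\mathcal{G}$-adic sequence is a strictly increasing sequence of positive integers $\mathcal{G} = (g_i)_{i=0}^{\infty}$ such that $g_0 = 1$ and $g_{i-1}$ divides $g_i$ for all $i \geq 1$. Put $d_i = g_i/g_{i-1}$ for $i \ge 1$ (so $d_i \geq 2$). For a nonempty set $W \subseteq \mathbf{N}_0$, let $\mathcal{F}^*(W)$ be the set of all nonempty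 finite subsets of $W$, and define $$A_{\mathcal{G}}(W) = \left\{ \sum_{j \in F} x_j g_j : F \in \mathcal{F}^*(W) \text{ and } x_j \in [1, d_{j+1}-1] \text{ for all } j \in F \right\}.$$ A partition of $\mathbf{N}_0$ is a sequence $\mathcal{W} = (W_i)_{i=0}^{h-1}$ of nonempty pairwise disjoint sets such that $\mathbf{N}_0 = W_0 \cup W_1 \cup \cdots \cup W_{h-1}$. *)

theory Defs
  imports Complex_Main "HOL-Library.Disjoint_Sets"
begin

text \<open>The integer endpoints may be negative; only the members are restricted to the naturals.\<close>
definition nat_interval :: "int \<Rightarrow> int \<Rightarrow> nat set" where
  "nat_interval u v = {x. u \<le> int x \<and> int x \<le> v}"

definition hfold_sumset :: "nat \<Rightarrow> nat set \<Rightarrow> nat set" where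
  "hfold_sumset h A = {\<Sum>i<h. a i | a. \<forall>i<h. a i \<in> A}"

definition asymptotic_basis :: "nat \<Rightarrow> nat set \<Rightarrow> bool" where
  "asymptotic_basis h A \<longleftrightarrow> (\<forall>\<^sub>F n in sequentially. n \<in> hfold_sumset h A)"

definition minimal_asymptotic_basis :: "nat \<Rightarrow> nat set \<Rightarrow> bool" where
  "minimal_asymptotic_basis h A \<longleftrightarrow>
     asymptotic_basis h A \<and> (\<forall>B. B \<subset> A \<longrightarrow> \<not> asymptotic_basis h B)"

definition adic_sequence :: "(nat \<Rightarrow> nat) \<Rightarrow> bool" where
  "adic_sequence g \<longleftrightarrow> strict_mono g \<and> g 0 = 1 \<and> (\<forall>i\<ge>1. g (i - 1) dvd g i)"

text \<open>Used only for \<open>i \<ge> 1\<close>, where the division is exact for an adic sequence and the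
  quotient is at least 2.\<close>
definition adic_quotient :: "(nat \<Rightarrow> nat) \<Rightarrow> nat \<Rightarrow> nat" where
  "adic_quotient g i = g i div g (i - 1)"

definition adic_set :: "(nat \<Rightarrow> nat) \<Rightarrow> nat set \<Rightarrow> nat set" where
  "adic_set g W =
     {\<Sum>j\<in>F. x j * g j | F x. finite F \<and> F \<noteq> {} \<and> F \<subseteq> W \<and>
        (\<forall>j\<in>F. x j \<in> {1..adic_quotient g (j + 1) - 1})}"

text \<open>The sequence \<open>W 0, \<dots>, W (h - 1)\<close>; values of \<open>W\<close> at indices \<open>\<ge> h\<close> are irrelevant.\<close>
definition nat_partition :: "nat \<Rightarrow> (nat \<Rightarrow> nat set) \<Rightarrow> bool" where
  "nat_partition h W \<longleftrightarrow>
     (\<forall>i<h. W i \<noteq> {}) \<and> disjoint_family_on W {..<h} \<and> (\<Union>i<h. W i) = UNIV"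

end

theory Submission
  imports Defs
begin

text \<open>Every \<open>n\<close> splits, according to the parts containing its nonzero digits, into at most \<open>h\<close>
  elements of the set. If there are fewer than \<open>h\<close> of them and \<open>n \<ge> g h\<close>, remove one
  \<open>g k\<close> with \<open>k \<ge> h\<close> from \<open>n\<close> and supply the missing summands by iterating
  \<open>g k = (d - 1) * g (k - 1) + g (k - 1)\<close>.

  For minimality, let \<open>a\<close> have its digits in \<open>W i\<close>, the lowest nonzero one at position \<open>u\<close>.
  Let \<open>n\<close> have the digits of \<open>a\<close> in \<open>W i\<close>, maximal digits at the other positions below
  \<open>u\<close>, and a digit 1 at the top of a far block of every \<open>W j\<close> with \<open>j \<noteq> i\<close>. Since
  \<open>h \<le> 2 ^ (t - 1)\<close>, a sum of \<open>h\<close> elements none of which has a digit in such a block cannot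
  carry through it, so each \<open>W j\<close> with \<open>j \<noteq> i\<close> must contribute a summand to \<open>n\<close>. If the
  remaining summand did not come from \<open>W i\<close>, there would be no carry into position \<open>u\<close> and
  the digit of \<open>n\<close> there would vanish. Hence every part contributes exactly one summand, and
  the one from \<open>W i\<close> is \<open>a\<close>.\<close>

section \<open>Sumsets\<close>

lemma hfold_sumset_0: "0 \<in> hfold_sumset 0 A"
  by (simp add: hfold_sumset_def)

lemma hfold_sumset_1: "a \<in> A \<Longrightarrow> a \<in> hfold_sumset 1 A"
  by (auto simp: hfold_sumset_def intro!: exI[of _ "\<lambda>_. a"])

lemma hfold_sumset_add:
  assumes "m \<in> hfold_sumset r A" "n \<in> hfold_sumset s A"
  shows "m + n \<in> hfold_sumset (r + s) A"
proof -
  obtain a b where a: "m = (\<Sum>i<r. a i)" "\<forall>i<r. a i \<in> A"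
    and b: "n = (\<Sum>i<s. b i)" "\<forall>i<s. b i \<in> A"
    using assms by (auto simp: hfold_sumset_def)
  define c where "c i = (if i < r then a i else b (i - r))" for i
  have "(\<Sum>i<r + s. c i) = (\<Sum>i<r. c i) + (\<Sum>i=r..<r + s. c i)"
    using sum.atLeastLessThan_concat[of 0 r "r + s" c] by (simp add: lessThan_atLeast0)
  also have "(\<Sum>i=r..<r + s. c i) = (\<Sum>i<s. b i)"
    using sum.shift_bounds_nat_ivl[of c 0 r s] by (simp add: c_def lessThan_atLeast0 add.commute)
  also have "(\<Sum>i<r. c i) = (\<Sum>i<r. a i)"
    by (simp add: c_def)
  finally have "m + n = (\<Sum>i<r + s. c i)"
    using a b by simp
  moreover have "\<forall>i<r + s. c i \<in> A"
    using a b by (auto simp: c_def)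
  ultimately show ?thesis
    by (auto simp: hfold_sumset_def)
qed

lemma sum_in_hfold_sumset:
  assumes "finite J" "\<And>j. j \<in> J \<Longrightarrow> f j \<in> A"
  shows "(\<Sum>j\<in>J. f j) \<in> hfold_sumset (card J) A"
  using assms
proof (induction J rule: finite_induct)
  case empty
  then show ?case by (simp add: hfold_sumset_0)
next
  case (insert j J)
  then have "f j + sum f J \<in> hfold_sumset (1 + card J) A"
    by (intro hfold_sumset_add hfold_sumset_1) auto
  with insert show ?case by simp
qed

section \<open>Digits with respect to an adic sequence\<close>

locale adic =
  fixes g :: "nat \<Rightarrow> nat"
  assumes adic_sequence: "adic_sequence g"
begin

text \<open>Shifted by one so that \<open>d q\<close> is the base at position \<open>q\<close>:
  digits there range over \<open>0\<close> to \<open>d q - 1\<close>.\<close>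

abbreviation d :: "nat \<Rightarrow> nat" where
  "d q \<equiv> adic_quotient g (Suc q)"

definition digit :: "nat \<Rightarrow> nat \<Rightarrow> nat" where
  "digit n q = n div g q mod d q"

lemma g_0: "g 0 = 1"
  and g_strict_mono: "strict_mono g"
  using adic_sequence by (auto simp: adic_sequence_def)

lemma g_pos: "g q > 0"
  using g_0 strict_mono_less_eq[OF g_strict_mono, of 0 q] by simp

lemma g_Suc: "g (Suc q) = d q * g q"
proof -
  have "g (Suc q - 1) dvd g (Suc q)"
    using adic_sequence unfolding adic_sequence_def by (metis le_add1 plus_1_eq_Suc)
  then show ?thesis
    by (simp add: adic_quotient_def)
qed

lemma d_ge_2: "d q \<ge> 2"
proof (rule ccontr)
  assume "\<not> d q \<ge> 2"
  then have "d q * g q \<le> 1 * g q"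
    by (intro mult_right_mono) auto
  then show False
    using strict_monoD[OF g_strict_mono, of q "Suc q"] by (simp add: g_Suc)
qed

lemma g_dvd: "q \<le> r \<Longrightarrow> g q dvd g r"
  by (induction r rule: dec_induct) (auto simp: g_Suc)

text \<open>Every ratio is at least 2. Through this bound the condition
  \<open>h \<le> 2 ^ (m - s)\<close> limits how far carries can travel.\<close>

lemma power_2_mult_g_le: "2 ^ k * g q \<le> g (q + k)"
proof (induction k)
  case (Suc k)
  have "2 * (2 ^ k * g q) \<le> d (q + k) * g (q + k)"
    using Suc d_ge_2 by (intro mult_mono) auto
  then show ?case by (simp add: g_Suc)
qed simp

lemma le_g: "q \<le> g q"
  using strict_mono_imp_increasing[OF g_strict_mono] by simp

lemma less_g_Suc: "n < g (Suc n)"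
  using le_g[of "Suc n"] by simp

lemma digit_less: "digit n q < d q"
  using d_ge_2[of q] by (simp add: digit_def)

lemma digit_0 [simp]: "digit 0 q = 0"
  by (simp add: digit_def)

lemma mod_g_Suc: "n mod g (Suc q) = n mod g q + digit n q * g q"
  using mod_mult2_eq[of n "g q" "d q"] by (simp add: g_Suc digit_def mult.commute)

lemma digit_eq_mod_div: "digit n q = n mod g (Suc q) div g q"
  using g_pos[of q] by (simp add: mod_g_Suc)

lemma mod_g: "n mod g K = (\<Sum>q<K. digit n q * g q)"
  by (induction K) (auto simp: g_0 mod_g_Suc)

lemma digit_expansion:
  assumes "n < g K"
  shows "n = (\<Sum>q<K. digit n q * g q)"
  using mod_g[of n K] assms by simp

lemma digit_eq_0: "n < g K \<Longrightarrow> K \<le> q \<Longrightarrow> digit n q = 0"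
  using strict_mono_less_eq[OF g_strict_mono, of K q] by (simp add: digit_def)

lemma digit_nonzero_less: "digit n q \<noteq> 0 \<Longrightarrow> n < g K \<Longrightarrow> q < K"
  using digit_eq_0 by (meson not_le)

lemma eq_if_digits_eq:
  assumes "\<And>q. digit m q = digit n q"
  shows "m = n"
proof -
  let ?K = "Suc (m + n)"
  have "m < g ?K" "n < g ?K"
    using le_g[of ?K] by simp_all
  moreover have "m mod g ?K = n mod g ?K"
    by (simp only: mod_g assms)
  ultimately show ?thesis
    by simp
qed

lemma nonzero_digit:
  assumes "n \<noteq> 0"
  obtains q where "digit n q \<noteq> 0"
  using eq_if_digits_eq[of n 0] assms by auto

lemma digit_sum_less:
  assumes "\<And>q. q < K \<Longrightarrow> x q < d q"
  shows "(\<Sum>q<K. x q * g q) < g K"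
  using assms
proof (induction K)
  case 0
  then show ?case by (simp add: g_0)
next
  case (Suc K)
  have "(\<Sum>q<Suc K. x q * g q) < g K + x K * g K"
    using Suc by simp
  also have "\<dots> = Suc (x K) * g K"
    by simp
  also have "\<dots> \<le> d K * g K"
    using Suc.prems[of K] by (intro mult_right_mono) auto
  finally show ?case by (simp add: g_Suc)
qed

lemma digit_sum_mod:
  assumes "\<And>q. q < K \<Longrightarrow> x q < d q" "L \<le> K"
  shows "(\<Sum>q<K. x q * g q) mod g L = (\<Sum>q<L. x q * g q)"
proof -
  have "(\<Sum>q<K. x q * g q) = (\<Sum>q<L. x q * g q) + (\<Sum>q=L..<K. x q * g q)"
    using sum.atLeastLessThan_concat[of 0 L K "\<lambda>q. x q * g q"] assms(2)
    by (simp add: lessThan_atLeast0)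
  moreover have "g L dvd (\<Sum>q=L..<K. x q * g q)"
    by (intro dvd_sum dvd_mult g_dvd) auto
  moreover have "(\<Sum>q<L. x q * g q) < g L"
    using assms by (intro digit_sum_less) auto
  ultimately show ?thesis
    by (auto elim!: dvdE)
qed

text \<open>Uniqueness of the expansion: terms above \<open>p\<close> vanish modulo
  \<open>g (Suc p)\<close>, and terms below \<open>p\<close> total less than
  \<open>g p\<close>.\<close>

lemma digit_digit_sum:
  assumes "\<And>q. q < K \<Longrightarrow> x q < d q" "p < K"
  shows "digit (\<Sum>q<K. x q * g q) p = x p"
proof -
  have "(\<Sum>q<K. x q * g q) mod g (Suc p) = (\<Sum>q<p. x q * g q) + x p * g p"
    using digit_sum_mod[of K x "Suc p"] assms by simp
  moreover have "(\<Sum>q<p. x q * g q) < g p"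
    using assms by (intro digit_sum_less) auto
  ultimately show ?thesis
    using g_pos[of p] by (simp add: digit_eq_mod_div)
qed

text \<open>Zero coefficients are allowed here, unlike in \<open>adic_set\<close>; the witness for
  \<open>F\<close> is the support of \<open>x\<close>.\<close>

lemma digit_sum_in_adic_set:
  assumes "\<And>q. q < K \<Longrightarrow> x q < d q" "\<And>q. q < K \<Longrightarrow> x q \<noteq> 0 \<Longrightarrow> q \<in> V"
    and "q < K" "x q \<noteq> 0"
  shows "(\<Sum>q<K. x q * g q) \<in> adic_set g V"
proof -
  let ?F = "{q. q < K \<and> x q \<noteq> 0}"
  have "(\<Sum>q<K. x q * g q) = (\<Sum>q\<in>?F. x q * g q)"
    by (intro sum.mono_neutral_right) auto
  moreover have "\<forall>q\<in>?F. x q \<in> {1..adic_quotient g (q + 1) - 1}"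
    using assms(1) by fastforce
  moreover have "finite ?F" "?F \<noteq> {}" "?F \<subseteq> V"
    using assms by auto
  ultimately show ?thesis
    unfolding adic_set_def by blast
qed

text \<open>Since expansions are unique, the existential representation can be replaced by a
  condition on the digits of \<open>b\<close> itself.\<close>

lemma adic_set_iff: "b \<in> adic_set g V \<longleftrightarrow> b \<noteq> 0 \<and> (\<forall>q. digit b q \<noteq> 0 \<longrightarrow> q \<in> V)"
proof
  assume "b \<in> adic_set g V"
  then obtain F x where F: "b = (\<Sum>j\<in>F. x j * g j)" "finite F" "F \<noteq> {}" "F \<subseteq> V"
    and x: "\<And>j. j \<in> F \<Longrightarrow> x j \<in> {1..d j - 1}"
    by (auto simp: adic_set_def)
  \<comment> \<open>Padding with zeros turns the sum over \<open>F\<close> into an expansion over an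
    initial segment.\<close>
  define y where "y q = (if q \<in> F then x q else 0)" for q
  obtain K where K: "F \<subseteq> {..<K}"
    using F(2) by (auto simp: finite_nat_set_iff_bounded)
  have b: "b = (\<Sum>q<K. y q * g q)"
    unfolding F(1) using K by (intro sum.mono_neutral_cong_left) (auto simp: y_def)
  have y: "y q < d q" for q
    using x[of q] d_ge_2[of q] by (auto simp: y_def)
  have bK: "b < g K"
    unfolding b using y by (intro digit_sum_less)
  have dig: "digit b q = y q" if "q < K" for q
    unfolding b using y that by (intro digit_digit_sum)
  obtain j where j: "j \<in> F" "j < K"
    using F K by blast
  then have "digit b j \<noteq> 0"
    using x[of j] dig[of j] by (auto simp: y_def)
  then have "b \<noteq> 0"
    by (metis digit_0)
  moreover have "q \<in> V" if "digit b q \<noteq> 0" for q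
  proof -
    have "q < K"
      using that bK by (rule digit_nonzero_less)
    then show ?thesis
      using that dig[of q] F(4) by (auto simp: y_def split: if_splits)
  qed
  ultimately show "b \<noteq> 0 \<and> (\<forall>q. digit b q \<noteq> 0 \<longrightarrow> q \<in> V)"
    by blast
next
  assume b: "b \<noteq> 0 \<and> (\<forall>q. digit b q \<noteq> 0 \<longrightarrow> q \<in> V)"
  then obtain q where q: "digit b q \<noteq> 0"
    using nonzero_digit by blast
  have "(\<Sum>q<Suc b. digit b q * g q) \<in> adic_set g V"
    using b q digit_less digit_nonzero_less[OF q less_g_Suc]
    by (intro digit_sum_in_adic_set) auto
  then show "b \<in> adic_set g V"
    using digit_expansion[OF less_g_Suc[of b]] by simp
qed

lemma mult_g_in_adic_set:
  assumes "q \<in> V" "1 \<le> c" "c < d q"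
  shows "c * g q \<in> adic_set g V"
proof -
  have "c * g q = (\<Sum>j\<in>{q}. c * g j)"
    by simp
  then show ?thesis
    unfolding adic_set_def using assms by (intro CollectI exI[of _ "{q}"] exI[of _ "\<lambda>_. c"]) auto
qed

text \<open>No carries reach position \<open>m\<close>: the residues modulo \<open>g (m + 1)\<close> are all below \<open>g s\<close>.\<close>
lemma digit_sum_zero_block:
  fixes h s m :: nat
  assumes zero: "\<And>l q. l < h \<Longrightarrow> s \<le> q \<Longrightarrow> q \<le> m \<Longrightarrow> digit (b l) q = 0"
    and "s \<le> m" "h \<le> 2 ^ (m - s)" "h > 0"
  shows "digit (\<Sum>l<h. b l) m = 0"
proof -
  have red: "b l mod g r = b l mod g s" if "l < h" "s \<le> r" "r \<le> Suc m" for l r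
    using that(2,3)
  proof (induction r rule: dec_induct)
    case (step r)
    then show ?case
      using zero[OF that(1), of r] by (simp add: mod_g_Suc)
  qed simp
  have "(\<Sum>l<h. b l) mod g (Suc m) = (\<Sum>l<h. b l mod g (Suc m)) mod g (Suc m)"
    by (simp add: mod_sum_eq)
  also have "\<dots> \<le> (\<Sum>l<h. b l mod g (Suc m))"
    by simp
  also have "\<dots> = (\<Sum>l<h. b l mod g s)"
    using assms(2) by (intro sum.cong refl red) auto
  also have "\<dots> < (\<Sum>l<h. g s)"
    using assms(4) g_pos by (intro sum_strict_mono) auto
  also have "\<dots> \<le> 2 ^ (m - s) * g s"
    using assms(3) by simp
  also have "\<dots> \<le> g m"
    using power_2_mult_g_le[of "m - s" s] assms(2) by simp
  finally show ?thesis
    by (simp add: digit_eq_mod_div)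
qed

end

section \<open>Partitions\<close>

locale adic_partition = adic +
  fixes h :: nat and W :: "nat \<Rightarrow> nat set"
  assumes partition: "nat_partition h W"
begin

definition adic_union :: "nat set" where
  "adic_union = (\<Union>i<h. adic_set g (W i))"

lemma part_unique: "i < h \<Longrightarrow> j < h \<Longrightarrow> q \<in> W i \<Longrightarrow> q \<in> W j \<Longrightarrow> i = j"
  using partition by (auto simp: nat_partition_def disjoint_family_on_def)

lemma part_exists:
  obtains i where "i < h" "q \<in> W i"
  using partition unfolding nat_partition_def by blast

lemma sum_over_parts:
  assumes "finite I"
  shows "(\<Sum>q\<in>I. f q) = (\<Sum>j<h. \<Sum>q\<in>I \<inter> W j. f q)"
proof -
  have "I = (\<Union>j<h. I \<inter> W j)"
    using part_exists by blast
  moreover have "(\<Sum>q\<in>(\<Union>j<h. I \<inter> W j). f q) = (\<Sum>j<h. \<Sum>q\<in>I \<inter> W j. f q)"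
    using assms part_unique by (intro sum.UNION_disjoint) blast+
  ultimately show ?thesis
    by simp
qed

lemma mult_g_in_adic_union:
  assumes "1 \<le> c" "c < d q"
  shows "c * g q \<in> adic_union"
proof -
  obtain i where "i < h" "q \<in> W i"
    by (rule part_exists)
  then show ?thesis
    using assms mult_g_in_adic_set unfolding adic_union_def by blast
qed

subsection \<open>The basis property\<close>

text \<open>Collecting the terms part by part gives one summand for each part that carries a nonzero
  coefficient.\<close>

lemma digit_sum_in_hfold_sumset:
  assumes "\<And>q. q < K \<Longrightarrow> x q < d q"
  shows "(\<Sum>q<K. x q * g q)
    \<in> hfold_sumset (card {j. j < h \<and> (\<exists>q\<in>W j. q < K \<and> x q \<noteq> 0)}) adic_union"
proof -
  let ?J = "{j. j < h \<and> (\<exists>q\<in>W j. q < K \<and> x q \<noteq> 0)}"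
  let ?f = "\<lambda>j. \<Sum>q<K. (if q \<in> W j then x q else 0) * g q"
  have f: "?f j = (\<Sum>q\<in>{..<K} \<inter> W j. x q * g q)" for j
    by (intro sum.mono_neutral_cong_right) auto
  have "(\<Sum>q<K. x q * g q) = (\<Sum>j<h. ?f j)"
    using sum_over_parts[of "{..<K}"] f by simp
  also have "\<dots> = (\<Sum>j\<in>?J. ?f j)"
    by (intro sum.mono_neutral_right) auto
  also have "\<dots> \<in> hfold_sumset (card ?J) adic_union"
  proof (rule sum_in_hfold_sumset)
    fix j assume "j \<in> ?J"
    then obtain q where q: "j < h" "q \<in> W j" "q < K" "x q \<noteq> 0"
      by blast
    have "?f j \<in> adic_set g (W j)"
      using assms q d_ge_2 by (intro digit_sum_in_adic_set[of _ _ _ q])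
        (fastforce split: if_splits)+
    then show "?f j \<in> adic_union"
      using q by (auto simp: adic_union_def)
  qed simp
  finally show ?thesis .
qed

text \<open>Each splitting adds one summand and lowers the index by one, so \<open>k\<close> allows
  up to \<open>k\<close> splittings.\<close>

lemma g_in_hfold_sumset: "m \<le> k \<Longrightarrow> g k \<in> hfold_sumset (Suc m) adic_union"
proof (induction m arbitrary: k)
  case 0
  have "1 * g k \<in> adic_union"
    using d_ge_2[of k] by (intro mult_g_in_adic_union) auto
  then show ?case
    using hfold_sumset_1 by fastforce
next
  case (Suc m)
  then obtain k' where k: "k = Suc k'" "m \<le> k'"
    by (cases k) auto
  have "(d k' - 1) * g k' \<in> adic_union"
    using d_ge_2[of k'] by (intro mult_g_in_adic_union) auto
  then have "(d k' - 1) * g k' + g k' \<in> hfold_sumset (1 + Suc m) adic_union"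
    using Suc.IH k by (intro hfold_sumset_add hfold_sumset_1) auto
  moreover have "(d k' - 1) * g k' + g k' = g k"
    using d_ge_2[of k'] by (simp add: k g_Suc algebra_simps)
  ultimately show ?case by simp
qed

lemma in_hfold_sumset:
  assumes "n \<ge> g h"
  shows "n \<in> hfold_sumset h adic_union"
proof -
  let ?K = "Suc n"
  let ?J = "\<lambda>x. {j. j < h \<and> (\<exists>q\<in>W j. q < ?K \<and> x q \<noteq> 0)}"
  have n: "n = (\<Sum>q<?K. digit n q * g q)"
    by (intro digit_expansion less_g_Suc)
  have sub: "?J x \<subseteq> {..<h}" for x :: "nat \<Rightarrow> nat"
    by auto
  show ?thesis
  proof (cases "card (?J (digit n)) = h")
    case True
    then show ?thesis
      using digit_sum_in_hfold_sumset[of ?K "digit n"] digit_less n by metis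
  next
    case False
    have "card (?J (digit n)) \<le> h"
      using card_mono[OF _ sub] by simp
    with False have card_J: "card (?J (digit n)) < h"
      by simp
    have "\<exists>k\<ge>h. digit n k \<noteq> 0"
    proof (rule ccontr)
      assume "\<not> (\<exists>k\<ge>h. digit n k \<noteq> 0)"
      then have "n = (\<Sum>q<h. digit n q * g q)"
        using le_g[of h] assms by (subst n, intro sum.mono_neutral_right) auto
      then have "n < g h"
        using digit_sum_less[of h "digit n"] digit_less by metis
      then show False
        using assms by simp
    qed
    then obtain k where k: "k \<ge> h" "digit n k \<noteq> 0"
      by blast
    have kK: "k < ?K"
      using k(2) less_g_Suc by (rule digit_nonzero_less)
    \<comment> \<open>Taking one \<open>g k\<close> out of \<open>n\<close> needs no borrowing, and
      it cannot increase the number of parts in use.\<close>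
    define x where "x = (digit n)(k := digit n k - 1)"
    have "(\<Sum>q<?K. digit n q * g q) = digit n k * g k + (\<Sum>q\<in>{..<?K} - {k}. digit n q * g q)"
      using kK by (intro sum.remove) auto
    also have "\<dots> = g k + (x k * g k + (\<Sum>q\<in>{..<?K} - {k}. x q * g q))"
      using k(2) by (cases "digit n k") (auto simp: x_def)
    also have "x k * g k + (\<Sum>q\<in>{..<?K} - {k}. x q * g q) = (\<Sum>q<?K. x q * g q)"
      using kK by (intro sum.remove[symmetric]) auto
    finally have n_eq: "n = (\<Sum>q<?K. x q * g q) + g k"
      using n by simp
    have "card (?J x) \<le> card (?J (digit n))"
      by (intro card_mono) (auto simp: x_def split: if_splits)
    then have less: "card (?J x) < h"
      using card_J by simp
    have "x q < d q" for q
      using digit_less[of n q] by (auto simp: x_def)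
    then have "(\<Sum>q<?K. x q * g q) \<in> hfold_sumset (card (?J x)) adic_union"
      by (intro digit_sum_in_hfold_sumset)
    \<comment> \<open>The removed \<open>g k\<close> supplies all \<open>h - card (?J x)\<close>
      missing summands, a positive number.\<close>
    moreover have "g k \<in> hfold_sumset (Suc (h - card (?J x) - 1)) adic_union"
      using k by (intro g_in_hfold_sumset) auto
    ultimately have "(\<Sum>q<?K. x q * g q) + g k
        \<in> hfold_sumset (card (?J x) + Suc (h - card (?J x) - 1)) adic_union"
      by (rule hfold_sumset_add)
    then show ?thesis
      using less n_eq by simp
  qed
qed

lemma asymptotic_basis_adic_union: "asymptotic_basis h adic_union"
  unfolding asymptotic_basis_def eventually_sequentially
  by (intro exI[of _ "g h"] allI impI in_hfold_sumset)

subsection \<open>Minimality\<close>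

text \<open>With each part used exactly once, at most one summand is nonzero at any given position,
  so the addition has no carries.\<close>

lemma digit_sum_bij:
  assumes b: "\<And>l. l < h \<Longrightarrow> b l \<in> adic_set g (W (c l))"
    and c: "bij_betw c {..<h} {..<h}"
    and l: "l < h" "q \<in> W (c l)"
  shows "digit (\<Sum>l<h. b l) q = digit (b l) q"
proof -
  define K where "K = Suc (q + (\<Sum>l<h. b l))"
  have bK: "b l' < g K" if "l' < h" for l'
  proof -
    have "b l' \<le> (\<Sum>l<h. b l)"
      using that by (intro member_le_sum) auto
    also have "\<dots> < g K"
      using le_g[of K] by (simp add: K_def)
    finally show ?thesis .
  qed
  have single: "(\<Sum>l<h. digit (b l) p) = digit (b k) p" if "k < h" "p \<in> W (c k)" for k p
  proof -
    have "digit (b l) p = 0" if "l < h" "l \<noteq> k" for l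
    proof (rule ccontr)
      assume "digit (b l) p \<noteq> 0"
      then have "p \<in> W (c l)"
        using b[OF that(1)] by (simp add: adic_set_iff)
      then have "c l = c k"
        using part_unique that \<open>k < h\<close> \<open>p \<in> W (c k)\<close> c bij_betwE by (metis lessThan_iff)
      then show False
        using that \<open>k < h\<close> c by (auto simp: bij_betw_def inj_on_def)
    qed
    then have "(\<Sum>l<h. digit (b l) p) = (\<Sum>l\<in>{k}. digit (b l) p)"
      using \<open>k < h\<close> by (intro sum.mono_neutral_right) auto
    then show ?thesis by simp
  qed
  have "(\<Sum>l<h. b l) = (\<Sum>l<h. \<Sum>p<K. digit (b l) p * g p)"
    by (intro sum.cong refl digit_expansion bK) auto
  also have "\<dots> = (\<Sum>p<K. (\<Sum>l<h. digit (b l) p) * g p)"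
    by (subst sum.swap) (simp add: sum_distrib_right)
  finally have eq: "(\<Sum>l<h. b l) = (\<Sum>p<K. (\<Sum>l<h. digit (b l) p) * g p)" .
  \<comment> \<open>Surjectivity of \<open>c\<close> provides the one summand whose part contains
    \<open>p\<close>.\<close>
  have "(\<Sum>l<h. digit (b l) p) < d p" for p
  proof -
    obtain i where i: "i < h" "p \<in> W i"
      by (rule part_exists)
    then have "i \<in> c ` {..<h}"
      using c by (simp add: bij_betw_def)
    then obtain k where "k < h" "c k = i"
      by auto
    then show ?thesis
      using i single[of k p] digit_less by simp
  qed
  then have "digit (\<Sum>l<h. b l) q = (\<Sum>l<h. digit (b l) q)"
    unfolding eq by (intro digit_digit_sum) (auto simp: K_def)
  then show ?thesis
    using single l by simp
qed

text \<open>Because one part goes unused while only one other part can be repeated, the residues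
  modulo \<open>g u\<close> add up to less than \<open>T + g u\<close>, where \<open>T\<close> is the largest value attainable with
  digits outside \<open>W i\<close>; since the sum is congruent to \<open>T\<close>, there is no carry into position \<open>u\<close>.\<close>
lemma digit_sum_unused_part:
  assumes b: "\<And>l. l < h \<Longrightarrow> b l \<in> adic_set g (W (c l))"
    and c: "c ` {..<h} = {..<h} - {i}"
    and i: "i < h" "u \<in> W i"
    and full: "\<And>q. q < u \<Longrightarrow> digit (\<Sum>l<h. b l) q = (if q \<in> W i then 0 else d q - 1)"
  shows "digit (\<Sum>l<h. b l) u = 0"
proof -
  define n where "n = (\<Sum>l<h. b l)"
  define T where "T = (\<Sum>q\<in>{..<u} - W i. (d q - 1) * g q)"
  have c_less: "c l < h" "c l \<noteq> i" if "l < h" for l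
    using c that by blast+
  have nT: "n mod g u = T"
  proof -
    have "n mod g u = (\<Sum>q<u. (if q \<in> W i then 0 else d q - 1) * g q)"
      unfolding n_def mod_g by (intro sum.cong) (auto simp: full)
    also have "\<dots> = T"
      unfolding T_def by (intro sum.mono_neutral_cong_right) auto
    finally show ?thesis .
  qed
  \<comment> \<open>Pigeonhole: \<open>h\<close> summands fall into \<open>h - 1\<close> parts.
    Setting aside one member \<open>l0\<close> of a collision makes the rest use each of these parts
    exactly once.\<close>
  have "\<not> inj_on c {..<h}"
  proof
    assume "inj_on c {..<h}"
    then have "card ({..<h} - {i}) = h"
      using card_image c by fastforce
    then show False
      using i by simp
  qed
  then obtain l0 l1 where l01: "l0 < h" "l1 < h" "l0 \<noteq> l1" "c l0 = c l1"
    by (auto simp: inj_on_def)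
  have im: "c ` ({..<h} - {l0}) = {..<h} - {i}"
  proof -
    have "c ` {..<h} = c ` ({..<h} - {l0})"
      using l01 by (auto simp: image_iff)
    then show ?thesis
      using c by simp
  qed
  have inj: "inj_on c ({..<h} - {l0})"
    using i l01 by (intro eq_card_imp_inj_on) (auto simp: im)
  \<comment> \<open>Summands from distinct parts other than \<open>W i\<close> occupy disjoint sets
    of positions, so even with maximal digits they total at most \<open>T\<close>.\<close>
  have "(\<Sum>l\<in>{..<h} - {l0}. b l mod g u)
      \<le> (\<Sum>l\<in>{..<h} - {l0}. \<Sum>q\<in>({..<u} - W i) \<inter> W (c l). (d q - 1) * g q)"
  proof (rule sum_mono)
    fix l assume l: "l \<in> {..<h} - {l0}"
    then have lh: "l < h" by simp
    have "b l mod g u = (\<Sum>q<u. digit (b l) q * g q)"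
      by (rule mod_g)
    also have "\<dots> = (\<Sum>q\<in>({..<u} - W i) \<inter> W (c l). digit (b l) q * g q)"
      using b[OF lh] part_unique[OF c_less(1)[OF lh] i(1)] c_less[OF lh]
      by (intro sum.mono_neutral_right) (auto simp: adic_set_iff)
    also have "\<dots> \<le> (\<Sum>q\<in>({..<u} - W i) \<inter> W (c l). (d q - 1) * g q)"
    proof (intro sum_mono mult_right_mono)
      fix q show "digit (b l) q \<le> d q - 1"
        using digit_less[of "b l" q] by simp
    qed simp
    finally show "b l mod g u \<le> (\<Sum>q\<in>({..<u} - W i) \<inter> W (c l). (d q - 1) * g q)" .
  qed
  also have "\<dots> = (\<Sum>j\<in>{..<h} - {i}. \<Sum>q\<in>({..<u} - W i) \<inter> W j. (d q - 1) * g q)"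
    using sum.reindex[OF inj, of "\<lambda>j. \<Sum>q\<in>({..<u} - W i) \<inter> W j. (d q - 1) * g q"] im by simp
  also have "\<dots> \<le> (\<Sum>j<h. \<Sum>q\<in>({..<u} - W i) \<inter> W j. (d q - 1) * g q)"
    by (intro sum_mono2) auto
  also have "\<dots> = T"
    unfolding T_def by (rule sum_over_parts[symmetric]) simp
  finally have le_T: "(\<Sum>l\<in>{..<h} - {l0}. b l mod g u) \<le> T" .
  define S where "S = (\<Sum>l<h. b l mod g u)"
  have "S = b l0 mod g u + (\<Sum>l\<in>{..<h} - {l0}. b l mod g u)"
    unfolding S_def using l01 by (intro sum.remove) auto
  also have "\<dots> < g u + T"
    using le_T g_pos[of u] by (intro add_less_le_mono) auto
  finally have S_less: "S < g u + T" .
  have ST: "S mod g u = T"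
    using nT unfolding S_def n_def by (simp add: mod_sum_eq)
  \<comment> \<open>\<open>S\<close> is \<open>T\<close> plus a multiple of \<open>g u\<close> and
    lies below \<open>g u + T\<close>, so that multiple is zero.\<close>
  have "S < g u"
  proof (rule ccontr)
    assume "\<not> S < g u"
    then have "S div g u \<ge> 1"
      using g_pos[of u] by (simp add: Suc_le_eq div_greater_zero_iff)
    then have "1 * g u \<le> S div g u * g u"
      by (intro mult_right_mono) auto
    then show False
      using S_less ST div_mult_mod_eq[of S "g u"] by linarith
  qed
  have "digit (b l) u = 0" if "l < h" for l
  proof (rule ccontr)
    assume "digit (b l) u \<noteq> 0"
    then have "u \<in> W (c l)"
      using b[OF that] by (simp add: adic_set_iff)
    then show False
      using part_unique[OF c_less(1)[OF that] i(1)] i(2) c_less[OF that] by blast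
  qed
  \<comment> \<open>No summand has a digit at \<open>u\<close>, so only a carry could make that
    digit of the sum nonzero.\<close>
  then have "S = (\<Sum>l<h. b l mod g (Suc u))"
    unfolding S_def by (intro sum.cong) (auto simp: mod_g_Suc)
  then have "n mod g (Suc u) = S mod g (Suc u)"
    unfolding n_def by (simp add: mod_sum_eq)
  also have "\<dots> \<le> S"
    by simp
  finally show ?thesis
    using \<open>S < g u\<close> unfolding n_def by (simp add: digit_eq_mod_div)
qed

text \<open>Isolates the digit conditions on \<open>n\<close> that force \<open>a\<close> into every
  representation; \<open>u\<close> is the lowest nonzero position of \<open>a\<close>, and
  \<open>{s j..m j}\<close> is the block in \<open>W j\<close>.\<close>

lemma summand_forced:
  assumes i: "i < h"
    and a: "a \<in> adic_set g (W i)"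
    and u: "digit a u \<noteq> 0" "\<And>q. q < u \<Longrightarrow> digit a q = 0"
    and blocks: "\<And>j. j < h \<Longrightarrow> j \<noteq> i \<Longrightarrow>
      s j \<le> m j \<and> h \<le> 2 ^ (m j - s j) \<and> {s j..m j} \<subseteq> W j \<and> digit n (m j) \<noteq> 0"
    and low: "\<And>q. q < u \<Longrightarrow> q \<notin> W i \<Longrightarrow> digit n q = d q - 1"
    and part: "\<And>q. q \<in> W i \<Longrightarrow> digit n q = digit a q"
    and B: "B \<subseteq> adic_union" and n: "n \<in> hfold_sumset h B"
  shows "a \<in> B"
proof -
  obtain b where b: "n = (\<Sum>l<h. b l)" "\<And>l. l < h \<Longrightarrow> b l \<in> B"
    using n by (auto simp: hfold_sumset_def)
  have "\<forall>l\<in>{..<h}. \<exists>j. j < h \<and> b l \<in> adic_set g (W j)"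
    using b(2) B by (auto simp: adic_union_def)
  from bchoice[OF this] obtain c
    where c: "\<forall>l\<in>{..<h}. c l < h \<and> b l \<in> adic_set g (W (c l))"
    by (rule exE)
  then have c_less: "\<And>l. l < h \<Longrightarrow> c l < h"
    and bc: "\<And>l. l < h \<Longrightarrow> b l \<in> adic_set g (W (c l))"
    by simp_all
  have uW: "u \<in> W i"
    using a u by (simp add: adic_set_iff)
  have used: "j \<in> c ` {..<h}" if j: "j < h" "j \<noteq> i" for j
  proof (rule ccontr)
    assume unused: "j \<notin> c ` {..<h}"
    have "digit (b l) q = 0" if "l < h" "s j \<le> q" "q \<le> m j" for l q
    proof (rule ccontr)
      assume "digit (b l) q \<noteq> 0"
      then have "q \<in> W (c l)"
        using bc[OF that(1)] by (simp add: adic_set_iff)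
      moreover have "q \<in> W j"
        using blocks[OF j] that(2,3) by auto
      ultimately have "c l = j"
        using part_unique[OF c_less[OF that(1)] j(1)] by simp
      then show False
        using unused that(1) by auto
    qed
    then have "digit (\<Sum>l<h. b l) (m j) = 0"
      using blocks[OF j] j(1) by (intro digit_sum_zero_block[of h "s j"]) auto
    then show False
      using blocks[OF j] b(1) by simp
  qed
  have c_sub: "c ` {..<h} \<subseteq> {..<h}"
    using c_less by auto
  have "i \<in> c ` {..<h}"
  proof (rule ccontr)
    assume "i \<notin> c ` {..<h}"
    then have "c ` {..<h} = {..<h} - {i}"
      using used c_sub by blast
    moreover have "digit n q = (if q \<in> W i then 0 else d q - 1)" if "q < u" for q
      using that low part u(2) by simp
    ultimately have "digit n u = 0"
      using digit_sum_unused_part[OF bc _ i uW] unfolding b(1) by simp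
    then show False
      using part uW u(1) by simp
  qed
  then have surj: "c ` {..<h} = {..<h}"
    using used c_sub by blast
  then have bij: "bij_betw c {..<h} {..<h}"
    by (simp add: bij_betw_def eq_card_imp_inj_on)
  \<comment> \<open>The summand from \<open>W i\<close> inherits the digits of \<open>n\<close> on
    \<open>W i\<close>, which are those of \<open>a\<close>, and both vanish elsewhere.\<close>
  obtain l where l: "l < h" "c l = i"
    using \<open>i \<in> c ` {..<h}\<close> by auto
  have "b l = a"
  proof (rule eq_if_digits_eq)
    fix q
    show "digit (b l) q = digit a q"
    proof (cases "q \<in> W i")
      case True
      then have "digit n q = digit (b l) q"
        unfolding b(1) using digit_sum_bij[OF bc bij l(1)] l by simp
      then show ?thesis
        using part True by simp
    next
      case False
      then have "digit (b l) q = 0" "digit a q = 0"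
        using bc[OF l(1)] a l(2) by (auto simp: adic_set_iff)
      then show ?thesis by simp
    qed
  qed
  then show ?thesis
    using b(2) l by blast
qed

lemma not_asymptotic_basis_if_missing:
  assumes h: "h \<ge> 2"
    and blocks: "\<And>i N. i < h \<Longrightarrow> \<exists>s m. N \<le> m \<and> s \<le> m \<and> h \<le> 2 ^ (m - s) \<and> {s..m} \<subseteq> W i"
    and i: "i < h" and a: "a \<in> adic_set g (W i)"
    and B: "B \<subseteq> adic_union" "a \<notin> B"
  shows "\<not> asymptotic_basis h B"
proof
  assume "asymptotic_basis h B"
  then obtain N where N: "\<And>n. n \<ge> N \<Longrightarrow> n \<in> hfold_sumset h B"
    by (auto simp: asymptotic_basis_def eventually_sequentially)
  have "a \<noteq> 0"
    using a by (simp add: adic_set_iff)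
  then obtain p where p: "digit a p \<noteq> 0"
    by (rule nonzero_digit)
  define u where "u = (LEAST q. digit a q \<noteq> 0)"
  have u: "digit a u \<noteq> 0"
    unfolding u_def by (rule LeastI[of "\<lambda>q. digit a q \<noteq> 0", OF p])
  have u_least: "digit a q = 0" if "q < u" for q
    using not_less_Least[of q "\<lambda>q. digit a q \<noteq> 0"] that unfolding u_def by simp
  \<comment> \<open>In the bound \<open>N + u\<close>, the term \<open>N\<close> makes the
    constructed number large, and \<open>u\<close> keeps the markers \<open>m j\<close> out of the
    range of maximal digits below \<open>u\<close>.\<close>
  have "\<forall>j\<in>{..<h}. \<exists>s m. N + u \<le> m \<and> s \<le> m \<and> h \<le> 2 ^ (m - s) \<and> {s..m} \<subseteq> W j"
    by (intro ballI blocks) simp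
  from bchoice[OF this] obtain s where "\<forall>j\<in>{..<h}. \<exists>m.
      N + u \<le> m \<and> s j \<le> m \<and> h \<le> 2 ^ (m - s j) \<and> {s j..m} \<subseteq> W j"
    by (rule exE)
  from bchoice[OF this] obtain m where "\<forall>j\<in>{..<h}.
      N + u \<le> m j \<and> s j \<le> m j \<and> h \<le> 2 ^ (m j - s j) \<and> {s j..m j} \<subseteq> W j"
    by (rule exE)
  then have sm: "N + u \<le> m j \<and> s j \<le> m j \<and> h \<le> 2 ^ (m j - s j) \<and> {s j..m j} \<subseteq> W j"
    if "j < h" for j
    using that by simp
  define M where "M = m ` ({..<h} - {i})"
  define x where "x q =
    (if q \<in> W i then digit a q else if q < u then d q - 1 else if q \<in> M then 1 else 0)" for q
  \<comment> \<open>A crude bound exceeding every position where \<open>x\<close> is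
    nonzero.\<close>
  define K where "K = Suc (a + u + (\<Sum>q\<in>M. q))"
  define n where "n = (\<Sum>q<K. x q * g q)"
  have M_less: "q < K" if "q \<in> M" for q
    using member_le_sum[of q M "\<lambda>q. q"] that by (auto simp: K_def M_def)
  have aK: "a < g K"
    using le_g[of K] by (simp add: K_def)
  have xd: "x q < d q" for q
    using d_ge_2[of q] digit_less[of a q] by (auto simp: x_def)
  have dig: "digit n q = x q" for q
  proof (cases "q < K")
    case True
    then show ?thesis
      unfolding n_def using xd by (intro digit_digit_sum)
  next
    case False
    then have "digit n q = 0"
      unfolding n_def using xd by (intro digit_eq_0[OF digit_sum_less]) auto
    moreover have "x q = 0"
      using False M_less digit_eq_0[OF aK] by (auto simp: x_def K_def)
    ultimately show ?thesis by simp
  qed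
  have m_digit: "digit n (m j) = 1" if j: "j < h" "j \<noteq> i" for j
  proof -
    have "m j \<in> W j"
      using sm[OF j(1)] by auto
    then have "m j \<notin> W i"
      using part_unique i j by blast
    then show ?thesis
      using sm[OF j(1)] j by (auto simp: dig x_def M_def)
  qed
  \<comment> \<open>Here \<open>h \<ge> 2\<close> enters: a second part exists, and its marker digit
    forces \<open>n \<ge> g (m j) \<ge> N\<close>.\<close>
  obtain j where j: "j < h" "j \<noteq> i"
  proof (cases "i = 0")
    case True
    then show ?thesis using that[of 1] h by simp
  next
    case False
    then show ?thesis using that[of 0] h by simp
  qed
  have "N \<le> m j"
    using sm[OF j(1)] by simp
  also have "\<dots> \<le> g (m j)"
    by (rule le_g)
  also have "\<dots> \<le> n"
  proof (rule ccontr)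
    assume "\<not> g (m j) \<le> n"
    then have "digit n (m j) = 0"
      by (intro digit_eq_0[of n "m j"]) auto
    then show False
      using m_digit[OF j] by simp
  qed
  finally have "n \<in> hfold_sumset h B"
    by (rule N)
  then have "a \<in> B"
    using sm m_digit B(1)
    by (intro summand_forced[OF i a u u_least, where n = n and s = s and m = m]) (auto simp: dig x_def)
  then show False
    using B(2) by simp
qed

end

theorem theorem3:
  fixes h :: nat and t :: int and W :: "nat \<Rightarrow> nat set" and g :: "nat \<Rightarrow> nat"
  assumes "h \<ge> 2"
    and "real_of_int t \<ge> 1 + ln (real h) / ln 2"
    and "nat_partition h W"
    and "\<forall>i<h. \<exists>M :: nat set. infinite M \<and> (\<forall>m\<in>M. m > 0) \<and>
           (\<forall>m\<in>M. nat_interval (int m - t + 1) (int m) \<subseteq> W i)"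
    and "adic_sequence g"
  shows "minimal_asymptotic_basis h (\<Union>i<h. adic_set g (W i))"
proof -
  interpret adic_partition g h W
    using assms by unfold_locales
  \<comment> \<open>A block of length \<open>t\<close> is \<open>{m - k..m}\<close>, and the
    logarithmic condition on \<open>t\<close> becomes \<open>h \<le> 2 ^ k\<close>.\<close>
  define k where "k = nat (t - 1)"
  have "0 \<le> ln (real h) / ln 2"
    using assms(1) by (intro divide_nonneg_pos) auto
  then have "t \<ge> 1"
    using assms(2) by linarith
  then have k: "t = 1 + int k"
    by (simp add: k_def)
  have h_le: "h \<le> 2 ^ k"
  proof -
    have "log 2 (real h) \<le> real k"
      using assms(2) k by (simp add: log_def)
    then have "real h \<le> 2 powr real k"
      using assms(1) by (simp add: log_le_iff)
    then have "real h \<le> real (2 ^ k)"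
      by (simp add: powr_realpow)
    then show ?thesis
      by (simp only: of_nat_le_iff)
  qed
  have blocks: "\<exists>s m. N \<le> m \<and> s \<le> m \<and> h \<le> 2 ^ (m - s) \<and> {s..m} \<subseteq> W i" if "i < h" for i N
  proof -
    from assms(4)[rule_format, OF that] obtain M
      where M: "infinite M" "\<forall>m\<in>M. nat_interval (int m - t + 1) (int m) \<subseteq> W i"
      by (elim exE conjE)
    \<comment> \<open>Exceeding \<open>k\<close> keeps the natural subtraction \<open>m - k\<close>
      exact.\<close>
    obtain m where m: "m \<in> M" "N + k < m"
      using M(1) unfolding finite_nat_set_iff_bounded_le by (meson not_le)
    have "{m - k..m} \<subseteq> nat_interval (int m - t + 1) (int m)"
      using m(2) by (auto simp: nat_interval_def k)
    then have "{m - k..m} \<subseteq> W i"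
      using M(2) m(1) by blast
    then show ?thesis
      using m(2) h_le by (intro exI[of _ "m - k"] exI[of _ m]) auto
  qed
  have "\<not> asymptotic_basis h B" if B: "B \<subset> adic_union" for B
  proof -
    obtain a where a: "a \<in> adic_union" "a \<notin> B"
      using B by blast
    then obtain i where i: "i < h" "a \<in> adic_set g (W i)"
      by (auto simp: adic_union_def)
    have "B \<subseteq> adic_union"
      using B by blast
    then show ?thesis
      using not_asymptotic_basis_if_missing[OF assms(1) blocks i] a(2) by simp
  qed
  then show ?thesis
    using asymptotic_basis_adic_union
    unfolding minimal_asymptotic_basis_def adic_union_def by blast
qed

end
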